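(* Let $\mathcal{F}$ be a nonempty family of finite loops such that: (1') if $L \in \mathcal{F}$ and $K$ is a subloop of $L$, then $K \in \mathcal{F}$; (2) if $L \in \mathcal{F}$ and $N$ is a normal subloop of $L$, then the factor loop $L/N$ belongs to $\mathcal{F}$; (3) every simple loop in $\mathcal{F}$ has the weak Lagrange property. Then every loop in $\mathcal{F}$ has the strong Lagrange property.
   Context: A loop is a set $L$ with a binary operation having a two-sided identity element $1$ such that for all $a,b\in L$ each of the equations $ax=b$ and $ya=b$ has a unique solution in $L$. A subloop of $L$ is a subset that is a loop under the restricted operation. A subloop $N$ of $L$ is normal if $xN=Nx$, $x(yN)=(xy)N$ and $(Nx)y=N(xy)$ for all $x,y\in L$ (equivalently, $N$ is the kernel of a loop homomorphism); then $L/N$ denotes the factor loop of cosets of $N$. A loop is simple if it has no normal subloops other than the trivial subloop and itself. A finite loop $L$ has the weak Lagrange property if, for every subloop $K$ of $L$, $|K|$ divides $|L|$. It has the strong Lagrange property if every subloop $K$ of $L$ has the weak Lagrange property. *)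

theory Defs
  imports "HOL-Algebra.Coset"
begin

locale loop =
  fixes L (structure)
  assumes m_closed: "\<lbrakk>x \<in> carrier L; y \<in> carrier L\<rbrakk> \<Longrightarrow> x \<otimes> y \<in> carrier L"
    and one_closed: "\<one> \<in> carrier L"
    and l_one: "x \<in> carrier L \<Longrightarrow> \<one> \<otimes> x = x"
    and r_one: "x \<in> carrier L \<Longrightarrow> x \<otimes> \<one> = x"
    and right_factor: "\<lbrakk>a \<in> carrier L; b \<in> carrier L\<rbrakk> \<Longrightarrow> \<exists>!x. x \<in> carrier L \<and> a \<otimes> x = b"
    and left_factor: "\<lbrakk>a \<in> carrier L; b \<in> carrier L\<rbrakk> \<Longrightarrow> \<exists>!y. y \<in> carrier L \<and> y \<otimes> a = b"

text \<open>A subloop is a subset that is a loop under the restricted operation. The record below keeps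
  the identity of the ambient loop; by \<open>subloop_iff_ex_one\<close> this is no restriction.\<close>

definition subloop :: "'a set \<Rightarrow> ('a, 'b) monoid_scheme \<Rightarrow> bool"
  where "subloop K L \<longleftrightarrow> K \<subseteq> carrier L \<and> loop (L\<lparr>carrier := K\<rparr>)"

lemma subloop_iff_ex_one:
  assumes "loop L"
  shows "subloop K L \<longleftrightarrow> K \<subseteq> carrier L \<and> (\<exists>e. loop (L\<lparr>carrier := K, one := e\<rparr>))"
proof
  assume "subloop K L"
  then have "K \<subseteq> carrier L" and "loop (L\<lparr>carrier := K, one := \<one>\<^bsub>L\<^esub>\<rparr>)"
    by (simp_all add: subloop_def)
  then show "K \<subseteq> carrier L \<and> (\<exists>e. loop (L\<lparr>carrier := K, one := e\<rparr>))" by blast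
next
  assume "K \<subseteq> carrier L \<and> (\<exists>e. loop (L\<lparr>carrier := K, one := e\<rparr>))"
  then obtain e where K: "K \<subseteq> carrier L" and e: "loop (L\<lparr>carrier := K, one := e\<rparr>)" by blast
  have eK: "e \<in> K" using loop.one_closed[OF e] by simp
  have "e \<otimes>\<^bsub>L\<^esub> e = e" using loop.l_one[OF e, of e] eK by simp
  moreover have "e \<otimes>\<^bsub>L\<^esub> \<one>\<^bsub>L\<^esub> = e" using loop.r_one[OF assms] eK K by blast
  moreover have "\<one>\<^bsub>L\<^esub> \<in> carrier L" using loop.one_closed[OF assms] .
  ultimately have "e = \<one>\<^bsub>L\<^esub>" using loop.right_factor[OF assms, of e e] eK K by blast
  then show "subloop K L" using e K by (simp add: subloop_def)
qed

definition normal_subloop :: "'a set \<Rightarrow> ('a, 'b) monoid_scheme \<Rightarrow> bool"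
  where "normal_subloop N L \<longleftrightarrow> subloop N L \<and>
    (\<forall>x\<in>carrier L. x <#\<^bsub>L\<^esub> N = N #>\<^bsub>L\<^esub> x) \<and>
    (\<forall>x\<in>carrier L. \<forall>y\<in>carrier L.
       x <#\<^bsub>L\<^esub> (y <#\<^bsub>L\<^esub> N) = (x \<otimes>\<^bsub>L\<^esub> y) <#\<^bsub>L\<^esub> N \<and>
       (N #>\<^bsub>L\<^esub> x) #>\<^bsub>L\<^esub> y = N #>\<^bsub>L\<^esub> (x \<otimes>\<^bsub>L\<^esub> y))"

text \<open>The factor loop is the library's \<^term>\<open>L Mod N\<close>, the set of cosets with the elementwise
  product; the next lemma shows that this is the usual product of cosets.\<close>

lemma coset_mult:
  fixes L (structure)
  assumes "loop L" "normal_subloop N L" and xy: "x \<in> carrier L" "y \<in> carrier L"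
  shows "(N #> x) <#> (N #> y) = N #> (x \<otimes> y)"
proof -
  interpret loop L by fact
  have sub: "N \<subseteq> carrier L" and N: "loop (L\<lparr>carrier := N\<rparr>)"
    and comm: "\<And>z. z \<in> carrier L \<Longrightarrow> z <# N = N #> z"
    and l: "\<And>u v. \<lbrakk>u \<in> carrier L; v \<in> carrier L\<rbrakk> \<Longrightarrow> u <# (v <# N) = (u \<otimes> v) <# N"
    and r: "\<And>u v. \<lbrakk>u \<in> carrier L; v \<in> carrier L\<rbrakk> \<Longrightarrow> (N #> u) #> v = N #> (u \<otimes> v)"
    using assms(2) by (auto simp: normal_subloop_def subloop_def)
  have nN: "n <# N = N" if "n \<in> N" for n
    using that loop.m_closed[OF N, of n] loop.right_factor[OF N, of n]
    by (auto simp: l_coset_def) metis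
  have xyc: "x \<otimes> y \<in> carrier L" using xy m_closed by blast
  have Nx: "N #> x \<subseteq> carrier L" using sub xy m_closed by (auto simp: r_coset_def)
  have "(N #> x) <#> (N #> y) = (\<Union>a\<in>N #> x. a <# (y <# N))"
    unfolding comm[OF xy(2)] by (simp add: set_mult_def l_coset_def)
  also have "\<dots> = (\<Union>a\<in>N #> x. (a \<otimes> y) <# N)"
    using l Nx xy by (intro SUP_cong) auto
  also have "\<dots> = (\<Union>c\<in>(N #> x) #> y. c <# N)"
    by (auto simp: r_coset_def)
  also have "\<dots> = (\<Union>c\<in>(x \<otimes> y) <# N. c <# N)"
    using r comm xyc xy by simp
  also have "\<dots> = (\<Union>n\<in>N. ((x \<otimes> y) \<otimes> n) <# N)"
    by (auto simp: l_coset_def)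
  also have "\<dots> = (\<Union>n\<in>N. (x \<otimes> y) <# (n <# N))"
    using l sub xyc by (intro SUP_cong) auto
  also have "\<dots> = (x \<otimes> y) <# N"
    using nN loop.one_closed[OF N] by auto
  finally show ?thesis using comm xyc by simp
qed

definition simple_loop :: "('a, 'b) monoid_scheme \<Rightarrow> bool"
  where "simple_loop L \<longleftrightarrow> loop L \<and>
    (\<forall>N. normal_subloop N L \<longrightarrow> N = {\<one>\<^bsub>L\<^esub>} \<or> N = carrier L)"

text \<open>The two Lagrange properties are meant for finite loops only.\<close>

definition weak_Lagrange :: "('a, 'b) monoid_scheme \<Rightarrow> bool"
  where "weak_Lagrange L \<longleftrightarrow> (\<forall>K. subloop K L \<longrightarrow> card K dvd card (carrier L))"

definition strong_Lagrange :: "('a, 'b) monoid_scheme \<Rightarrow> bool"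
  where "strong_Lagrange L \<longleftrightarrow> (\<forall>K. subloop K L \<longrightarrow> weak_Lagrange (L\<lparr>carrier := K\<rparr>))"

end

theory Submission
  imports Defs
begin

text \<open>The weak Lagrange property of every loop \<open>L\<close> in the family follows by strong induction on the
  order of \<open>L\<close>; the strong property is the weak one for all subloops, and these lie in the family.
  Simple loops have the weak property by assumption. Otherwise \<open>L\<close> has a normal subloop \<open>N\<close> different
  from \<open>L\<close> and from the trivial subloop, and \<open>projection_onto_isomorphic_copy\<close> gives a surjective
  homomorphism \<open>f\<close> with kernel \<open>N\<close> onto a loop \<open>M\<close> of the family that is isomorphic to \<open>L Mod N\<close>.

  Cosets of a subloop need not partition a loop, but the fibres of a homomorphism always do, and they
  are the left cosets of its kernel. So the order of a finite loop is the order of its image times that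
  of the kernel (\<open>card_eq_card_image_mult_card_kernel\<close>). For \<open>f\<close> on \<open>L\<close> and on a subloop \<open>K\<close> this reads
  \<open>|L| = |M| |N|\<close> and \<open>|K| = |f(K)| |K \<inter> N|\<close>. Now \<open>f(K)\<close> is a subloop of \<open>M\<close> and \<open>K \<inter> N\<close> is a subloop
  of \<open>N\<close> (\<open>subloop_if_finite_closed\<close>). As \<open>M\<close> and \<open>N\<close> are smaller than \<open>L\<close>, the induction hypothesis
  gives \<open>|f(K)|\<close> dividing \<open>|M|\<close> and \<open>|K \<inter> N|\<close> dividing \<open>|N|\<close>, so \<open>|K|\<close> divides \<open>|L|\<close>.\<close>

section \<open>Finite subloops\<close>

lemma (in loop) l_cancel:
  assumes "a \<in> carrier L" "x \<in> carrier L" "y \<in> carrier L"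
  shows "a \<otimes> x = a \<otimes> y \<longleftrightarrow> x = y"
  using right_factor[OF assms(1) m_closed[OF assms(1,3)]] assms by blast

lemma (in loop) r_cancel:
  assumes "a \<in> carrier L" "x \<in> carrier L" "y \<in> carrier L"
  shows "x \<otimes> a = y \<otimes> a \<longleftrightarrow> x = y"
  using left_factor[OF assms(1) m_closed[OF assms(3,1)]] assms by blast

text \<open>Translations by elements of \<open>K\<close> are injective self-maps of the finite set \<open>K\<close>, hence bijective;
  this is the unique solvability of \<open>ax = b\<close> and \<open>ya = b\<close> inside \<open>K\<close>.\<close>

lemma subloop_if_finite_closed:
  fixes L (structure)
  assumes "loop L" and fin: "finite K" and sub: "K \<subseteq> carrier L" and one: "\<one> \<in> K"
    and closed: "\<And>x y. \<lbrakk>x \<in> K; y \<in> K\<rbrakk> \<Longrightarrow> x \<otimes> y \<in> K"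
  shows "subloop K L"
proof -
  interpret loop L by fact
  have right: "\<exists>!x. x \<in> K \<and> a \<otimes> x = b" if "a \<in> K" "b \<in> K" for a b
  proof -
    have inj: "inj_on (\<lambda>x. a \<otimes> x) K"
      using that sub by (intro inj_onI) (simp add: l_cancel subset_iff)
    have "(\<lambda>x. a \<otimes> x) ` K = K"
      using that closed by (intro endo_inj_surj[OF fin _ inj]) auto
    then have "b \<in> (\<lambda>x. a \<otimes> x) ` K" using \<open>b \<in> K\<close> by simp
    then obtain x where "x \<in> K" "a \<otimes> x = b" by auto
    then show ?thesis using inj by (intro ex1I[of _ x]) (auto dest: inj_onD)
  qed
  have left: "\<exists>!y. y \<in> K \<and> y \<otimes> a = b" if "a \<in> K" "b \<in> K" for a b
  proof -
    have inj: "inj_on (\<lambda>y. y \<otimes> a) K"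
      using that sub by (intro inj_onI) (simp add: r_cancel subset_iff)
    have "(\<lambda>y. y \<otimes> a) ` K = K"
      using that closed by (intro endo_inj_surj[OF fin _ inj]) auto
    then have "b \<in> (\<lambda>y. y \<otimes> a) ` K" using \<open>b \<in> K\<close> by simp
    then obtain y where "y \<in> K" "y \<otimes> a = b" by auto
    then show ?thesis using inj by (intro ex1I[of _ y]) (auto dest: inj_onD)
  qed
  have "loop (L\<lparr>carrier := K\<rparr>)"
    using sub one closed right left l_one r_one by unfold_locales auto
  with sub show ?thesis by (simp add: subloop_def)
qed

section \<open>Homomorphisms of loops\<close>

text \<open>The image of the identity is idempotent, and cancellation leaves the identity as the only
  idempotent of a loop.\<close>

lemma loop_hom_one:
  assumes "loop L" "loop M" "f \<in> hom L M"
  shows "f \<one>\<^bsub>L\<^esub> = \<one>\<^bsub>M\<^esub>"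
proof -
  interpret L: loop L by fact
  interpret M: loop M by fact
  have "f \<one>\<^bsub>L\<^esub> \<in> carrier M"
    using assms(3) L.one_closed by (rule hom_in_carrier)
  moreover have "f \<one>\<^bsub>L\<^esub> \<otimes>\<^bsub>M\<^esub> f \<one>\<^bsub>L\<^esub> = f \<one>\<^bsub>L\<^esub>"
    using hom_mult[OF assms(3) L.one_closed L.one_closed] L.l_one L.one_closed by simp
  ultimately show ?thesis
    using M.l_cancel[OF _ _ M.one_closed] M.r_one by metis
qed

text \<open>Writing \<open>y = xn\<close>, the condition \<open>f(y) = f(x)\<close> becomes \<open>f(x)f(n) = f(x)\<close>,
  that is, \<open>f(n) = 1\<close>.\<close>

lemma fibre_eq_kernel_coset:
  assumes "loop L" "loop M" and f: "f \<in> hom L M" and x: "x \<in> carrier L"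
  shows "{y \<in> carrier L. f y = f x} = (\<lambda>n. x \<otimes>\<^bsub>L\<^esub> n) ` kernel L M f"
proof -
  interpret L: loop L by fact
  interpret M: loop M by fact
  have fx: "f x \<in> carrier M" using f x by (rule hom_in_carrier)
  have "f (x \<otimes>\<^bsub>L\<^esub> n) = f x \<longleftrightarrow> n \<in> kernel L M f" if n: "n \<in> carrier L" for n
  proof -
    have "f (x \<otimes>\<^bsub>L\<^esub> n) = f x \<otimes>\<^bsub>M\<^esub> f n" using f x n by (rule hom_mult)
    moreover have "f n \<in> carrier M" using f n by (rule hom_in_carrier)
    ultimately have "f (x \<otimes>\<^bsub>L\<^esub> n) = f x \<longleftrightarrow> f n = \<one>\<^bsub>M\<^esub>"
      using M.l_cancel[OF fx _ M.one_closed] M.r_one[OF fx] by simp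
    with n show ?thesis by (simp add: kernel_def)
  qed
  moreover have "kernel L M f \<subseteq> carrier L" by (auto simp: kernel_def)
  moreover have "\<exists>n\<in>carrier L. y = x \<otimes>\<^bsub>L\<^esub> n" if "y \<in> carrier L" for y
    using L.right_factor[OF x that] by blast
  ultimately show ?thesis using L.m_closed[OF x] by blast
qed

lemma card_eq_card_image_mult_card_kernel:
  assumes "loop L" "loop M" and f: "f \<in> hom L M" and fin: "finite (carrier L)"
  shows "card (carrier L) = card (f ` carrier L) * card (kernel L M f)"
proof -
  interpret L: loop L by fact
  have fibre: "card {y \<in> carrier L. f y = z} = card (kernel L M f)" if z_img: "z \<in> f ` carrier L" for z
  proof -
    obtain x where x: "x \<in> carrier L" and z: "z = f x" using z_img by blast
    have "inj_on (\<lambda>n. x \<otimes>\<^bsub>L\<^esub> n) (kernel L M f)"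
      using L.l_cancel[OF x] by (auto intro: inj_onI simp: kernel_def)
    then show ?thesis
      unfolding z fibre_eq_kernel_coset[OF assms(1,2) f x] by (rule card_image)
  qed
  have "card (carrier L) = (\<Sum>z\<in>f ` carrier L. card {y \<in> carrier L. f y = z})"
    using sum.image_gen[OF fin, of "\<lambda>_. 1::nat" f] by simp
  also have "\<dots> = card (f ` carrier L) * card (kernel L M f)"
    using fibre by simp
  finally show ?thesis .
qed

section \<open>Projection to the factor loop\<close>

text \<open>The composite of the projection onto \<open>L Mod N\<close> with an isomorphism to \<open>M\<close>. Passing to \<open>M\<close>
  replaces cosets by elements of a structure already known to be a loop.\<close>

lemma projection_onto_isomorphic_copy:
  fixes L (structure)
  assumes L: "loop L" and M: "loop M" and N: "normal_subloop N L" and iso: "M \<cong> L Mod N"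
  obtains f where "f \<in> hom L M" "f ` carrier L = carrier M" "kernel L M f = N"
proof -
  interpret loop L by fact
  have sub: "N \<subseteq> carrier L" and loopN: "loop (L\<lparr>carrier := N\<rparr>)"
    using N by (auto simp: normal_subloop_def subloop_def)
  obtain g where g: "g \<in> hom M (L Mod N)" and bij: "bij_betw g (carrier M) (rcosets N)"
    using iso by (auto simp: is_iso_def iso_def FactGroup_def)
  define h where "h = inv_into (carrier M) g"
  define f where "f = (\<lambda>x. h (N #> x))"
  have cosets: "rcosets N = (\<lambda>x. N #> x) ` carrier L" by (auto simp: RCOSETS_def)
  have h_bij: "bij_betw h (rcosets N) (carrier M)"
    unfolding h_def by (rule bij_betw_inv_into[OF bij])
  have gf: "g (f x) = N #> x" if "x \<in> carrier L" for x
    unfolding f_def h_def using that bij_betw_inv_into_right[OF bij] by (simp add: cosets)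
  have surj: "f ` carrier L = carrier M"
    using bij_betw_imp_surj_on[OF h_bij] by (simp add: cosets f_def image_image)
  have hom: "f \<in> hom L M"
  proof (rule homI)
    show fM: "f x \<in> carrier M" if "x \<in> carrier L" for x using surj that by blast
    fix x y assume x: "x \<in> carrier L" and y: "y \<in> carrier L"
    have "g (f x \<otimes>\<^bsub>M\<^esub> f y) = (N #> x) <#> (N #> y)"
      using hom_mult[OF g fM[OF x] fM[OF y]] gf x y by (simp add: FactGroup_def)
    also have "\<dots> = g (f (x \<otimes> y))"
      using coset_mult[OF L N x y] gf m_closed[OF x y] by simp
    finally show "f (x \<otimes> y) = f x \<otimes>\<^bsub>M\<^esub> f y"
      using bij_betw_imp_inj_on[OF bij] fM x y m_closed loop.m_closed[OF M]
      by (metis inj_onD)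
  qed
  have N_iff: "N #> x = N \<longleftrightarrow> x \<in> N" if x: "x \<in> carrier L" for x
  proof
    assume "N #> x = N"
    moreover have "\<one> \<otimes> x \<in> N #> x"
      using loop.one_closed[OF loopN] by (auto simp: r_coset_def)
    ultimately show "x \<in> N" using l_one[OF x] by simp
  next
    assume "x \<in> N"
    then show "N #> x = N"
      using loop.m_closed[OF loopN, of _ x] loop.left_factor[OF loopN, of x]
      by (auto simp: r_coset_def) metis
  qed
  have "f x = \<one>\<^bsub>M\<^esub> \<longleftrightarrow> x \<in> N" if x: "x \<in> carrier L" for x
  proof -
    have "f x = \<one>\<^bsub>M\<^esub> \<longleftrightarrow> f x = f \<one>" using loop_hom_one[OF L M hom] by simp
    also have "\<dots> \<longleftrightarrow> N #> x = N #> \<one>"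
      using gf x one_closed by (metis f_def)
    also have "N #> \<one> = N"
      using N_iff[OF one_closed] loop.one_closed[OF loopN] by simp
    finally show ?thesis using N_iff[OF x] by simp
  qed
  then have "kernel L M f = N" using sub by (auto simp: kernel_def)
  with hom surj that show thesis by blast
qed

section \<open>The Lagrange properties\<close>

text \<open>The order of a subloop \<open>K\<close> factors along \<open>f\<close> as the order of \<open>L\<close> does, and each factor of \<open>|K|\<close>
  is the order of a subloop of \<open>M\<close> or of \<open>N\<close>.\<close>

lemma weak_Lagrange_extension:
  assumes L: "loop L" and fin: "finite (carrier L)" and M: "loop M"
    and f: "f \<in> hom L M" and surj: "f ` carrier L = carrier M"
    and ker: "kernel L M f = N" and N: "loop (L\<lparr>carrier := N\<rparr>)"
    and wN: "weak_Lagrange (L\<lparr>carrier := N\<rparr>)" and wM: "weak_Lagrange M"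
  shows "weak_Lagrange L"
  unfolding weak_Lagrange_def
proof (intro allI impI)
  fix K assume "subloop K L"
  then have sub: "K \<subseteq> carrier L" and K: "loop (L\<lparr>carrier := K\<rparr>)" by (auto simp: subloop_def)
  have finK: "finite K" using sub fin by (rule finite_subset)
  have one: "\<one>\<^bsub>L\<^esub> \<in> K" using loop.one_closed[OF K] by simp
  have closed: "x \<otimes>\<^bsub>L\<^esub> y \<in> K" if "x \<in> K" "y \<in> K" for x y
    using loop.m_closed[OF K, of x y] that by simp
  have fK: "f \<in> hom (L\<lparr>carrier := K\<rparr>) M"
    using f sub unfolding hom_def by (auto simp: subset_iff)
  have mult: "f x \<otimes>\<^bsub>M\<^esub> f y = f (x \<otimes>\<^bsub>L\<^esub> y)" if "x \<in> K" "y \<in> K" for x y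
    using hom_mult[OF f] that sub by (simp add: subset_iff)
  have "subloop (f ` K) M"
  proof (rule subloop_if_finite_closed[OF M])
    show "\<one>\<^bsub>M\<^esub> \<in> f ` K" using loop_hom_one[OF L M f] one by (metis imageI)
  qed (use finK sub surj mult closed in auto)
  then have image: "card (f ` K) dvd card (carrier M)"
    using wM by (simp add: weak_Lagrange_def)
  have "subloop (K \<inter> N) (L\<lparr>carrier := N\<rparr>)"
  proof (rule subloop_if_finite_closed[OF N])
    fix x y assume "x \<in> K \<inter> N" "y \<in> K \<inter> N"
    then show "x \<otimes>\<^bsub>L\<lparr>carrier := N\<rparr>\<^esub> y \<in> K \<inter> N"
      using closed loop.m_closed[OF N, of x y] by auto
  qed (use finK one loop.one_closed[OF N] in auto)
  then have inter: "card (K \<inter> N) dvd card N"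
    using wN by (simp add: weak_Lagrange_def)
  have "kernel (L\<lparr>carrier := K\<rparr>) M f = K \<inter> N" using ker sub by (auto simp: kernel_def)
  then have "card K = card (f ` K) * card (K \<inter> N)"
    using card_eq_card_image_mult_card_kernel[OF K M fK] finK by simp
  moreover have "card (carrier L) = card (carrier M) * card N"
    using card_eq_card_image_mult_card_kernel[OF L M f fin] surj ker by simp
  ultimately show "card K dvd card (carrier L)"
    using image inter by (simp add: mult_dvd_mono)
qed

(* The cosets forming L Mod N are sets, so L Mod N has another type than the members of F;
   that it belongs to F is therefore expressed up to isomorphism. *)
theorem corollary1:
  fixes F :: "'a monoid set"
  assumes "F \<noteq> {}"
    and "\<And>L. L \<in> F \<Longrightarrow> loop L \<and> finite (carrier L)"
    and "\<And>L K. L \<in> F \<Longrightarrow> subloop K L \<Longrightarrow> L\<lparr>carrier := K\<rparr> \<in> F"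
    and "\<And>L N. L \<in> F \<Longrightarrow> normal_subloop N L \<Longrightarrow> \<exists>M\<in>F. M \<cong> L Mod N"
    and "\<And>L. L \<in> F \<Longrightarrow> simple_loop L \<Longrightarrow> weak_Lagrange L"
  shows "\<forall>L\<in>F. strong_Lagrange L"
proof -
  have weak: "weak_Lagrange L" if "L \<in> F" for L
    using that
  proof (induction "card (carrier L)" arbitrary: L rule: less_induct)
    case less
    have L: "loop L" and fin: "finite (carrier L)" using assms(2) less.prems by blast+
    show ?case
    proof (cases "simple_loop L")
      case True
      with less.prems show ?thesis by (rule assms(5))
    next
      case False
      then obtain N where N: "normal_subloop N L" and N1: "N \<noteq> {\<one>\<^bsub>L\<^esub>}" and NL: "N \<noteq> carrier L"
        using L by (auto simp: simple_loop_def)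
      have sN: "subloop N L" using N by (simp add: normal_subloop_def)
      then have sub: "N \<subseteq> carrier L" and loopN: "loop (L\<lparr>carrier := N\<rparr>)"
        by (auto simp: subloop_def)
      obtain M where MF: "M \<in> F" and "M \<cong> L Mod N" using assms(4) less.prems N by blast
      moreover have M: "loop M" and finM: "finite (carrier M)" using assms(2) MF by blast+
      ultimately obtain f where f: "f \<in> hom L M" "f ` carrier L = carrier M" "kernel L M f = N"
        using projection_onto_isomorphic_copy[OF L M N] by blast
      have "card N < card (carrier L)"
        using fin sub NL by (simp add: psubset_card_mono psubsetI)
      then have wN: "weak_Lagrange (L\<lparr>carrier := N\<rparr>)"
        using less.hyps[of "L\<lparr>carrier := N\<rparr>"] assms(3)[OF less.prems sN] by simp
      \<comment> \<open>The factor \<open>|N|\<close> of \<open>|L|\<close> is at least 2, so the other factor \<open>|M|\<close> is smaller than \<open>|L|\<close>.\<close>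
      have "card {\<one>\<^bsub>L\<^esub>} < card N"
        using N1 loop.one_closed[OF loopN] finite_subset[OF sub fin]
        by (intro psubset_card_mono) auto
      moreover have "0 < card (carrier M)"
        using finM loop.one_closed[OF M] by (auto simp: card_gt_0_iff)
      ultimately have "card (carrier M) < card (carrier L)"
        using card_eq_card_image_mult_card_kernel[OF L M f(1) fin] f(2,3) by simp
      then have "weak_Lagrange M" using MF by (rule less.hyps)
      with wN show ?thesis by (rule weak_Lagrange_extension[OF L fin M f loopN])
    qed
  qed
  show ?thesis using weak assms(3) by (simp add: strong_Lagrange_def)
qed

end
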